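(* Let $T$ be a tree, let $c$ be a labeling of $T$, and let $S=S_c(T)$ be the set of vertices that are consistent under $c$. Assume $|S|\ge 2$, and let $a,b\in S$ be the vertices with $$c(a)=\min\{c(x):x\in S\},\qquad c(b)=\max\{c(x):x\in S\}.$$ Let $P_{ab}$ be the unique $a$--$b$ path in $T$, written $P_{ab}=p_1p_2\cdots p_m$ with $p_1=a$ and $p_m=b$. Then: (i) $S\subseteq V(P_{ab})$; (ii) $c(p_i)=c(a)+i-1$ for $1\le i\le m$; in particular $c(b)=c(a)+m-1$ and $c(V(P_{ab}))=\{c(a),c(a)+1,\dots,c(b)\}$; (iii) every $z\in V(T)\setminus V(P_{ab})$ satisfies $c(z)<c(a)$ or $c(z)>c(b)$.
   Context: All graphs are finite, simple and connected; $d(u,v)$ denotes graph distance. For a graph $G$ on $n$ vertices, a labeling is a bijection $c:V(G)\to\{1,\dots,n\}$; write $c(u,v)=|c(u)-c(v)|$ and $c(A)=\{c(x):x\in A\}$ for $A\subseteq V(G)$. A vertex $u$ is (list-distance) consistent under $c$ if for all $v,w\in V(G)$, $d(u,v)<d(u,w)$ implies $c(u,v)\le c(u,w)$. $S_c(G)$ denotes the set of all consistent vertices under $c$. *)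

theory Defs
  imports "Graph_Theory.Graph_Theory"
begin

text \<open>Simple graphs are loop-free symmetric digraphs without parallel arcs (locale \<open>graph\<close>).
  The unit-cost instance of the library's shortest-path function is the graph distance.\<close>

definition graph_dist :: "('a, 'b) pre_digraph \<Rightarrow> 'a \<Rightarrow> 'a \<Rightarrow> ereal" where
  "graph_dist G u v = wf_digraph.\<mu> G (\<lambda>_. 1) u v"

text \<open>The predicate \<open>Digraph_Component.tree\<close> is unsuitable here: in a symmetric digraph,
  \<open>pre_digraph.cycle\<close> also holds of the closed walk that follows an edge back and forth.
  The bound 3 on the number of arcs excludes exactly these.\<close>

definition undirected_tree :: "('a, 'b) pre_digraph \<Rightarrow> bool" where
  "undirected_tree G \<longleftrightarrow> graph G \<and> Digraph_Component.connected G \<and>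
     \<not> (\<exists>p. pre_digraph.cycle G p \<and> 3 \<le> length p)"

definition labeling :: "('a, 'b) pre_digraph \<Rightarrow> ('a \<Rightarrow> nat) \<Rightarrow> bool" where
  "labeling G c \<longleftrightarrow> bij_betw c (verts G) {1..card (verts G)}"

definition label_dist :: "('a \<Rightarrow> nat) \<Rightarrow> 'a \<Rightarrow> 'a \<Rightarrow> int" where
  "label_dist c u v = \<bar>int (c u) - int (c v)\<bar>"

definition consistent :: "('a, 'b) pre_digraph \<Rightarrow> ('a \<Rightarrow> nat) \<Rightarrow> 'a \<Rightarrow> bool" where
  "consistent G c u \<longleftrightarrow> (\<forall>v\<in>verts G. \<forall>w\<in>verts G.
     graph_dist G u v < graph_dist G u w \<longrightarrow> label_dist c u v \<le> label_dist c u w)"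

definition consistent_verts :: "('a, 'b) pre_digraph \<Rightarrow> ('a \<Rightarrow> nat) \<Rightarrow> 'a set" where
  "consistent_verts G c = {u \<in> verts G. consistent G c u}"

end

theory Submission
  imports Defs
begin

text \<open>Along the path, the distance from \<open>a\<close> and the distance to \<open>b\<close> are strictly monotone, so
  consistency of \<open>a\<close> and \<open>b\<close> traps the labels of the path in \<open>{c a..c b}\<close> and makes them
  increasing. A vertex \<open>z\<close> off the path is further than its projection \<open>x\<close> onto the path
  both from \<open>a\<close> and from \<open>b\<close>; a label of \<open>z\<close> inside \<open>{c a..c b}\<close> would therefore be at once
  above and below the label of \<open>x\<close>. Hence the path carries all labels in the interval.\<close>

section \<open>From vertex lists to arc walks and cycles\<close>

lemma (in wf_digraph) vwalk_imp_awalk: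
  assumes "vwalk p G"
  obtains es where "awalk (hd p) es (last p)" and "awalk_verts (hd p) es = p"
proof -
  have "\<exists>es. awalk (hd p) es (last p) \<and> awalk_verts (hd p) es = p"
    using assms
  proof (induct p rule: vwalk_induct)
    case (Base u)
    then show ?case by (intro exI[of _ "[]"]) (simp add: awalk_Nil_iff)
  next
    case (Cons u v p)
    then obtain e es where "e \<in> arcs G" "tail G e = u" "head G e = v"
      and "awalk v es (last (v # p))" "awalk_verts v es = v # p"
      by (auto simp: arcs_ends_conv)
    then show ?case by (intro exI[of _ "e # es"]) (simp add: awalk_Cons_iff)
  qed
  with that show thesis by blast
qed

text \<open>Appending \<open>hd p\<close> to the vertex list gives a closed walk with one arc per
  vertex of \<open>p\<close>. The length is recorded because a two-vertex path also yields a
  \<open>cycle\<close>, by going back and forth along an edge; only length at least 3 contradicts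
  being a tree.\<close>

lemma (in wf_digraph) vpath_closed_imp_cycle:
  assumes "vpath p G" and "(last p, hd p) \<in> arcs_ends G"
  shows "\<exists>es. cycle es \<and> length es = length p"
proof -
  from assms(1) have "vwalk p G" "distinct p" "p \<noteq> []" by auto
  have "hd p \<in> verts G" using \<open>vwalk p G\<close> \<open>p \<noteq> []\<close> by (simp add: vwalk_verts_in_verts)
  with assms(2) have "vwalk ([last p, hd p]) G" by (auto simp: adj_in_verts)
  with \<open>vwalk p G\<close> have "vwalk (p \<oplus> [last p, hd p]) G"
    by (intro vwalk_joinI_vwalk') auto
  then have "vwalk (p @ [hd p]) G" by (simp add: vwalk_join_def)
  then obtain es where es: "awalk (hd (p @ [hd p])) es (last (p @ [hd p]))"
    and verts: "awalk_verts (hd (p @ [hd p])) es = p @ [hd p]"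
    by (rule vwalk_imp_awalk)
  from verts \<open>p \<noteq> []\<close> have len: "length es = length p"
    by (metis length_append_singleton length_awalk_verts nat.inject)
  have "awalk (hd p) es (hd p)" "awalk_verts (hd p) es = p @ [hd p]"
    using es verts \<open>p \<noteq> []\<close> by simp_all
  moreover have "distinct (tl (p @ [hd p]))"
    using \<open>distinct p\<close> \<open>p \<noteq> []\<close> by (cases p) auto
  ultimately have "cycle es" using len \<open>p \<noteq> []\<close> unfolding cycle_def by auto
  with len show ?thesis by blast
qed

section \<open>Uniqueness of paths in a tree\<close>

lemma vpath_Cons_Cons_iff:
  assumes "wf_digraph G"
  shows "vpath (u # v # p) G \<longleftrightarrow> (u, v) \<in> arcs_ends G \<and> u \<notin> set (v # p) \<and> vpath (v # p) G"
  using wf_digraph.vwalk_Cons_Cons[OF assms] by (auto simp: vpath_def)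

lemma vpath_rev:
  assumes "graph G" and "vpath p G"
  shows "vpath (rev p) G"
proof -
  interpret graph G by fact
  show ?thesis using assms(2) vwalk_rev_ex[OF sym_arcs] by (auto simp: vpath_def)
qed

text \<open>Suppose two paths leave their common start \<open>u\<close> towards different neighbours
  \<open>x\<close> and \<open>y\<close>. The remainders avoid \<open>u\<close> and meet at the
  common end, so they contain an \<open>x\<close>-\<open>y\<close> path avoiding \<open>u\<close>,
  and adding \<open>u\<close> closes it to a cycle. Hence the second vertices agree and induction
  applies to the remainders.\<close>

lemma vpath_unique:
  assumes "undirected_tree G" and "vpath p G" and "vpath q G"
    and "hd p = hd q" and "last p = last q"
  shows "p = q"
proof -
  interpret graph G using assms(1) by (simp add: undirected_tree_def)
  have no_cycle: "\<not> (cycle es \<and> 3 \<le> length es)" for es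
    using assms(1) by (auto simp: undirected_tree_def)
  show ?thesis using assms(2-)
  proof (induct p arbitrary: q)
    case Nil
    then show ?case by auto
  next
    case (Cons u p)
    show ?case
    proof (cases p)
      case Nil
      then show ?thesis using Cons.prems
        by (cases q) (auto simp: vpath_def split: if_splits)
    next
      case p: (Cons x p')
      have "u \<noteq> last (u # p)" using Cons.prems(1) p by (auto simp: vpath_def)
      then have "q \<noteq> [u]" using Cons.prems(4) by auto
      moreover have "q \<noteq> []" using Cons.prems by auto
      ultimately obtain y q' where q: "q = u # y # q'"
        using Cons.prems(3) by (metis list.sel(1) neq_Nil_conv)
      have px: "(u, x) \<in> arcs_ends G" "u \<notin> set (x # p')" "vpath (x # p') G"
        using Cons.prems(1) vpath_Cons_Cons_iff[OF wf_digraph] unfolding p by blast+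
      have qy: "(u, y) \<in> arcs_ends G" "u \<notin> set (y # q')" "vpath (y # q') G"
        using Cons.prems(2) vpath_Cons_Cons_iff[OF wf_digraph] unfolding q by blast+
      have lasts: "last (x # p') = last (y # q')" using Cons.prems(4) p q by simp
      have "x = y"
      proof (rule ccontr)
        assume "x \<noteq> y"
        \<comment> \<open>\<open>?w\<close> goes from \<open>x\<close> to the common end and back to
          \<open>y\<close>. The remainders may share further vertices, so it is shortened to the
          path \<open>?r\<close>.\<close>
        let ?w = "(x # p') \<oplus> rev (y # q')"
        let ?r = "vwalk_to_vpath ?w"
        have join: "joinable (x # p') (rev (y # q'))"
          using lasts by (auto simp: joinable_def hd_rev simp del: rev.simps)
        have "vwalk (x # p') G" "vwalk (rev (y # q')) G"
          using px(3) vpath_rev[OF _ qy(3)] by (auto intro: graph_axioms simp del: rev.simps)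
        then have "vwalk ?w G" using join by (rule vwalk_joinI_vwalk)
        then have r: "vpath ?r G" by (rule vwalk_to_vpath_vpath)
        have hd_r: "hd ?r = x" by (simp only: vwalk_to_vpath_hd vwalk_join_hd[OF join] list.sel)
        have last_r: "last ?r = y"
          by (simp only: vwalk_to_vpath_last vwalk_join_last[OF join] last_rev) simp
        have "set ?w \<subseteq> set (x # p') \<union> set (y # q')"
          unfolding vwalk_join_def using list.set_sel(2)[of "rev (y # q')"] by auto
        then have "u \<notin> set ?r" using px(2) qy(2) vwalk_to_vpath_subset by fastforce
        obtain r' where r': "?r = x # r'"
          using r hd_r by (metis list.collapse vpathE vwalkE)
        \<comment> \<open>As \<open>x\<close> and \<open>y\<close> differ, \<open>?r\<close> has at
          least two vertices; with \<open>u\<close> the cycle reaches the required length 3.\<close>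
        have "r' \<noteq> []" using last_r r' \<open>x \<noteq> y\<close> by auto
        have path: "vpath (u # ?r) G"
          unfolding r' vpath_Cons_Cons_iff[OF wf_digraph]
          using r px(1) \<open>u \<notin> set ?r\<close> unfolding r' by simp
        have "(last (u # ?r), hd (u # ?r)) \<in> arcs_ends G"
          using qy(1) last_r r' arcs_ends_symmetric[OF sym_arcs] by auto
        from vpath_closed_imp_cycle[OF path this] obtain es
          where "cycle es" "length es = length (u # ?r)" by blast
        moreover have "3 \<le> length (u # ?r)"
          unfolding r' using \<open>r' \<noteq> []\<close> by (cases r') auto
        ultimately show False using no_cycle by metis
      qed
      with Cons.hyps[of "y # q'"] px qy lasts p q show ?thesis by auto
    qed
  qed
qed

section \<open>Distances along a path and away from it\<close>

lemma graph_dist_vpath: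
  assumes tree: "undirected_tree G" and p: "vpath p G"
  shows "graph_dist G (hd p) (last p) = ereal (real (length p - 1))"
proof -
  interpret graph G using tree by (simp add: undirected_tree_def)
  \<comment> \<open>A cheapest walk can be taken to be a path \<open>es\<close>. Its vertex list has
    the ends of \<open>p\<close>, so by uniqueness it is \<open>p\<close>, and at unit cost the
    distance is the number of arcs.\<close>
  have "hd p \<rightarrow>\<^sup>*\<^bsub>G\<^esub> last p" using p by (auto simp: reachable_vpath_conv)
  then obtain es where es: "apath (hd p) es (last p)"
    and dist: "\<mu> (\<lambda>_. 1) (hd p) (last p) = awalk_cost (\<lambda>_. 1) es"
    using min_cost_awalk[of "hd p" "last p" "\<lambda>_. 1"] by auto
  have "vpath (awalk_verts (hd p) es) G"
    using es by (auto simp: apath_def vpath_def dest: awalk_imp_vwalk)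
  moreover have "hd (awalk_verts (hd p) es) = hd p" "last (awalk_verts (hd p) es) = last p"
    using es by (auto simp: apath_def)
  ultimately have "awalk_verts (hd p) es = p" using vpath_unique[OF tree _ p] by blast
  then have "length es = length p - 1" by (metis diff_Suc_1 length_awalk_verts)
  moreover have "awalk_cost (\<lambda>_. 1) es = length es"
    by (induct es) auto
  ultimately show ?thesis using dist by (simp add: graph_dist_def)
qed

lemma graph_dist_vpath_nth:
  assumes "undirected_tree G" and "vpath p G" and "i < length p"
  shows "graph_dist G (hd p) (p ! i) = ereal (real i)"
proof -
  have "p \<noteq> []" using assms(3) by auto
  have "vwalk (take (Suc i) p @ drop (Suc i) p) G" using assms(2) by auto
  then have "vwalk (take (Suc i) p) G" by (rule vwalkI_append_l[rotated]) (use \<open>p \<noteq> []\<close> in simp)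
  then have "vpath (take (Suc i) p) G" using assms(2) by (auto simp: vpath_def)
  from graph_dist_vpath[OF assms(1) this] have
    "graph_dist G (hd (take (Suc i) p)) (last (take (Suc i) p)) = ereal (real i)"
    using assms(3) by simp
  moreover have "hd (take (Suc i) p) = hd p" by simp
  moreover have "last (take (Suc i) p) = p ! i"
    unfolding take_Suc_conv_app_nth[OF assms(3)] by simp
  ultimately show ?thesis by simp
qed

lemma graph_dist_vpath_less_last:
  assumes "undirected_tree G" and "vpath p G" and "x \<in> set p" and "x \<noteq> last p"
  shows "graph_dist G (hd p) x < graph_dist G (hd p) (last p)"
proof -
  obtain i where i: "i < length p" "x = p ! i" using assms(3) by (metis in_set_conv_nth)
  with assms(4) have "i \<noteq> length p - 1" by (metis last_conv_nth length_0_conv less_nat_zero_code)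
  then show ?thesis
    using i graph_dist_vpath_nth[OF assms(1,2) i(1)] graph_dist_vpath[OF assms(1,2)] by simp
qed

text \<open>Here \<open>r\<close> branches off \<open>p\<close> at \<open>hd r\<close>. Following
  \<open>p\<close> up to \<open>hd r\<close> and then \<open>r\<close> gives a path, since the two
  meet only there; \<open>hd r\<close> lies on it strictly before its end
  \<open>last r\<close>.\<close>

lemma graph_dist_branch:
  assumes tree: "undirected_tree G" and p: "vpath p G" and r: "vpath r G"
    and "set p \<inter> set r = {hd r}" and "last r \<noteq> hd r"
  shows "graph_dist G (hd p) (hd r) < graph_dist G (hd p) (last r)"
proof -
  obtain ys zs where p_eq: "p = ys @ hd r # zs"
    using assms(4) by (metis IntD1 insertI1 split_list)
  let ?p = "ys @ [hd r]"
  let ?q = "?p \<oplus> r"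
  have "?p @ zs = p" using p_eq by simp
  then have "vwalk (?p @ zs) G" using p by (simp only: vpath_def)
  then have "vwalk ?p G" by (rule vwalkI_append_l[rotated]) simp
  then have "vwalk ?q G" using r by (intro vwalk_joinI_vwalk') auto
  moreover have "distinct ?q"
  proof -
    \<comment> \<open>The join drops the first vertex of \<open>r\<close>, so \<open>?p\<close> has
      to be disjoint only from \<open>tl r\<close>.\<close>
    have "hd r \<notin> set (tl r)" "distinct (tl r)" "set (tl r) \<subseteq> set r"
      using r by (cases r; auto simp: vpath_def)+
    moreover have "distinct p" using p by auto
    then have "distinct ?p" by (subst (asm) p_eq) simp
    moreover have "set ?p \<subseteq> set p" by (subst p_eq) auto
    moreover have "\<forall>x. x \<in> set p \<and> x \<in> set r \<longrightarrow> x = hd r"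
      using assms(4) by (metis IntI singletonD)
    ultimately have "set ?p \<inter> set (tl r) = {}" by (metis disjoint_iff subsetD)
    with \<open>distinct ?p\<close> \<open>distinct (tl r)\<close> show ?thesis by (simp add: vwalk_join_def)
  qed
  ultimately have q: "vpath ?q G" by auto
  have join: "joinable ?p r" using r by (intro joinableI) auto
  have "hd ?q = hd (ys @ hd r # zs)" by (simp add: vwalk_join_def hd_append)
  then have "hd ?q = hd p" by (simp only: p_eq[symmetric])
  moreover have "last ?q = last r" using join by (rule vwalk_join_last)
  moreover have "hd r \<in> set ?q" by (simp add: vwalk_join_def)
  ultimately show ?thesis
    using graph_dist_vpath_less_last[OF tree q, of "hd r"] assms(5) by simp
qed

text \<open>Take \<open>x\<close> to be the last vertex of \<open>p\<close> on a path from
  \<open>hd p\<close> to \<open>z\<close>. What follows \<open>x\<close> is a branch off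
  \<open>p\<close>, and equally off \<open>rev p\<close>, which yields the inequality for each
  end.\<close>

lemma vpath_projection:
  assumes tree: "undirected_tree G" and p: "vpath p G" and "z \<in> verts G" and "z \<notin> set p"
  obtains x where "x \<in> set p"
    and "graph_dist G (hd p) x < graph_dist G (hd p) z"
    and "graph_dist G (last p) x < graph_dist G (last p) z"
proof -
  interpret graph G using tree by (simp add: undirected_tree_def)
  have "p \<noteq> []" using p by auto
  then have "hd p \<in> verts G" using p by (meson hd_in_set vpathE vwalk_verts_in_verts)
  \<comment> \<open>Connectedness is stated through the symmetric closure, which has the same
    reachability as the symmetric graph itself.\<close>
  moreover have "\<forall>u \<in> verts G. \<forall>v \<in> verts G. u \<rightarrow>\<^sup>*\<^bsub>G\<^esub> v"
    using tree reachable_mk_symmetric_eq[OF sym_arcs]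
    by (auto simp: undirected_tree_def connected_def strongly_connected_def)
  ultimately have "hd p \<rightarrow>\<^sup>*\<^bsub>G\<^esub> z" using assms(3) by blast
  then obtain w where w: "vpath w G" "hd w = hd p" "last w = z"
    by (auto simp: reachable_vpath_conv)
  then have "\<exists>x\<in>set w. x \<in> set p" using \<open>p \<noteq> []\<close>
    by (metis hd_in_set vpathE vwalkE)
  then obtain ys x zs where w_eq: "w = ys @ x # zs" and x: "x \<in> set p"
    and zs: "\<forall>y\<in>set zs. y \<notin> set p"
    by (rule split_list_last_propE)
  let ?r = "x # zs"
  have "vwalk ?r G" using w(1) unfolding w_eq by (auto intro: vwalkI_append_r)
  then have r: "vpath ?r G" using w(1) w_eq by (auto simp: vpath_def)
  have last_r: "last ?r = z" using w(3) w_eq by simp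
  have "last ?r \<noteq> hd ?r" using last_r x assms(4) by auto
  moreover have "set p \<inter> set ?r = {hd ?r}" using x zs by auto
  moreover have "vpath (rev p) G" using p by (intro vpath_rev graph_axioms)
  ultimately have "graph_dist G (hd p) (hd ?r) < graph_dist G (hd p) (last ?r)"
    and "graph_dist G (hd (rev p)) (hd ?r) < graph_dist G (hd (rev p)) (last ?r)"
    by (intro graph_dist_branch tree p r; simp)+
  then show thesis unfolding last_r hd_rev list.sel by (rule that[OF x])
qed

section \<open>Labels on and off the path\<close>

theorem theorem3p3:
  fixes T :: "('a, 'b) pre_digraph" and c :: "'a \<Rightarrow> nat"
    and S :: "'a set" and a b :: 'a and p :: "'a list"
  assumes "undirected_tree T"
    and "labeling T c"
    and "S = consistent_verts T c"
    and "2 \<le> card S"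
    and "a \<in> S" and "c a = Min (c ` S)"
    and "b \<in> S" and "c b = Max (c ` S)"
    and "vpath p T" and "hd p = a" and "last p = b"
  shows "S \<subseteq> set p
    \<and> (\<forall>i\<in>{1..length p}. c (p ! (i - 1)) = c a + i - 1)
    \<and> c b = c a + length p - 1
    \<and> c ` set p = {c a..c b}
    \<and> (\<forall>z\<in>verts T - set p. c z < c a \<or> c z > c b)"
proof -
  interpret graph T using assms(1) by (simp add: undirected_tree_def)
  note tree = assms(1) and p = \<open>vpath p T\<close>
  have inj: "inj_on c (verts T)" and labels: "c ` verts T = {1..card (verts T)}"
    using assms(2) by (auto simp: labeling_def bij_betw_def)
  have "p \<noteq> []" using p by auto
  have p_verts: "set p \<subseteq> verts T" using p by auto
  have a: "a \<in> verts T" "consistent T c a" and b: "b \<in> verts T" "consistent T c b"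
    using assms(3,5,7) by (auto simp: consistent_verts_def)
  have "S \<subseteq> verts T" using assms(3) by (auto simp: consistent_verts_def)
  then have "finite S" using finite_verts finite_subset by blast
  then have S_labels: "c s \<in> {c a..c b}" if "s \<in> S" for s
    using that assms(6,8) by simp
  then have "c a \<le> c b" using assms(5) by fastforce
  have from_a: "label_dist c a v \<le> label_dist c a w"
    if "v \<in> verts T" "w \<in> verts T" "graph_dist T a v < graph_dist T a w" for v w
    using a(2) that by (simp add: consistent_def)
  have from_b: "label_dist c b v \<le> label_dist c b w"
    if "v \<in> verts T" "w \<in> verts T" "graph_dist T b v < graph_dist T b w" for v w
    using b(2) that by (simp add: consistent_def)
  have p_labels: "c x \<in> {c a..c b}" if x: "x \<in> set p" for x
  proof -
    \<comment> \<open>Consistency of \<open>a\<close> bounds the label above by \<open>c b\<close>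
      but still allows labels below \<open>c a\<close>; the bound from \<open>b\<close>, obtained on
      the reversed path, excludes these.\<close>
    have "label_dist c a x \<le> label_dist c a b"
      using from_a[of x b] graph_dist_vpath_less_last[OF tree p x] p_verts x b assms(10,11)
      by (cases "x = b") auto
    moreover have "label_dist c b x \<le> label_dist c b a"
      using from_b[of x a] graph_dist_vpath_less_last[OF tree vpath_rev[OF graph_axioms p], of x]
        p_verts x a assms(10,11) \<open>p \<noteq> []\<close>
      by (cases "x = a") (auto simp: hd_rev last_rev)
    ultimately show ?thesis using \<open>c a \<le> c b\<close> by (auto simp: label_dist_def)
  qed
  have mono: "c (p ! i) \<le> c (p ! j)" if "i < j" "j < length p" for i j
  proof -
    have "graph_dist T a (p ! i) < graph_dist T a (p ! j)"
      using graph_dist_vpath_nth[OF tree p] that assms(10) by auto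
    then have "label_dist c a (p ! i) \<le> label_dist c a (p ! j)"
      using that p_verts by (intro from_a) auto
    \<comment> \<open>Inside the interval \<open>label_dist c a\<close> is just the label minus
      \<open>c a\<close>, so comparing label distances compares labels.\<close>
    moreover have "c (p ! i) \<in> {c a..c b}" "c (p ! j) \<in> {c a..c b}"
      using that p_labels by auto
    ultimately show ?thesis by (auto simp: label_dist_def)
  qed
  have off_path: "c z \<notin> {c a..c b}" if z: "z \<in> verts T" "z \<notin> set p" for z
  proof
    assume cz: "c z \<in> {c a..c b}"
    obtain x where x: "x \<in> set p" "graph_dist T a x < graph_dist T a z"
      "graph_dist T b x < graph_dist T b z"
      using vpath_projection[OF tree p z] assms(10,11) by blast
    have "x \<in> verts T" using x(1) p_verts by blast
    then have "label_dist c a x \<le> label_dist c a z" "label_dist c b x \<le> label_dist c b z"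
      using from_a from_b x z by auto
    \<comment> \<open>Both labels lie in the interval, so the inequality from \<open>a\<close> says
      \<open>c x \<le> c z\<close> and the one from \<open>b\<close> says
      \<open>c z \<le> c x\<close>.\<close>
    with cz p_labels[OF x(1)] have "c x = c z" by (auto simp: label_dist_def)
    with inj \<open>x \<in> verts T\<close> z x(1) show False by (auto dest: inj_onD)
  qed
  have image: "c ` set p = {c a..c b}"
  proof
    show "c ` set p \<subseteq> {c a..c b}" using p_labels by blast
    \<comment> \<open>The labels fill an initial segment of the positive integers, so every number
      between \<open>c a\<close> and \<open>c b\<close> is the label of some vertex;
      \<open>off_path\<close> then puts that vertex on \<open>p\<close>.\<close>
    have "{c a..c b} \<subseteq> c ` verts T"
    proof -
      have "c a \<in> {1..card (verts T)}" "c b \<in> {1..card (verts T)}"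
        using a(1) b(1) labels by blast+
      then show ?thesis unfolding labels by auto
    qed
    then show "{c a..c b} \<subseteq> c ` set p" using off_path by blast
  qed
  \<comment> \<open>A sorted list without repetitions is determined by its set, so the labels read
    along \<open>p\<close> are exactly the interval in order. Repetitions are excluded by
    injectivity, as \<open>mono\<close> is only weak.\<close>
  have "sorted (map c p)" using mono by (auto simp: sorted_iff_nth_mono_less)
  moreover have "distinct (map c p)"
    using p inj_on_subset[OF inj p_verts] by (auto simp: vpath_def distinct_map)
  moreover have "set (map c p) = set [c a..<Suc (c b)]" using image by (simp add: atLeastLessThanSuc_atLeastAtMost del: upt_Suc)
  ultimately have list: "map c p = [c a..<Suc (c b)]"
    by (intro sorted_distinct_set_unique) (simp_all del: upt_Suc)
  then have len: "length p = Suc (c b) - c a" by (metis length_map length_upt)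
  have nth: "c (p ! i) = c a + i" if "i < length p" for i
  proof -
    have "c (p ! i) = [c a..<Suc (c b)] ! i" using list that by (metis nth_map)
    then show ?thesis using that len by (simp del: upt_Suc)
  qed
  show ?thesis
  proof (intro conjI)
    show "S \<subseteq> set p" using S_labels off_path \<open>S \<subseteq> verts T\<close> by blast
    show "\<forall>i\<in>{1..length p}. c (p ! (i - 1)) = c a + i - 1" using nth by auto
    show "c b = c a + length p - 1" using len \<open>c a \<le> c b\<close> by simp
    show "c ` set p = {c a..c b}" by (fact image)
    show "\<forall>z\<in>verts T - set p. c z < c a \<or> c z > c b" using off_path by fastforce
  qed
qed

end
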